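(* For every positive real number $c$, there exists a tree $T$ with simple eigenvalues such that \[ \left\lceil \frac{|V(T)|}{2} \right\rceil - \operatorname{rk}(\widehat{M}(T)) > c. \]
   Context: Graphs are finite, simple and undirected; a tree is a connected graph with no cycles. The eigenvalues of a graph $X$ are those of its adjacency matrix $A=A(X)$. A graph on $n$ vertices has simple eigenvalues if $A$ has $n$ distinct eigenvalues. The transition matrix of the continuous-time quantum walk on $X$ is $U(t)=\exp(itA)$, the mixing matrix is $M(t)=U(t)\circ\overline{U(t)}$, where $\circ$ denotes the entrywise (Schur/Hadamard) product, and the average mixing matrix of $X$ is \[ \widehat{M}=\widehat{M}(X)=\lim_{T\to\infty}\frac1T\int_0^T M(t)\,dt . \] (In this formula $T$ is a real time parameter.) $\operatorname{rk}$ denotes matrix rank. *)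

theory Defs
  imports
    "HOL-Analysis.Analysis"
    "Graph_Theory.Graph_Theory"
    "Jordan_Normal_Form.DL_Rank"
    "Jordan_Normal_Form.Spectral_Radius"
begin

text \<open>
  A finite simple undirected graph is a \<^locale>\<open>pair_graph\<close>: a finite, loop-free, symmetric
  digraph without parallel arcs, where each edge is the pair of its two orientations.
  The library's \<^const>\<open>Digraph_Component.tree\<close> is not the undirected notion for such a graph:
  it counts the closed walk \<open>u, v, u\<close> along a single edge as a cycle. An undirected cycle is a
  cycle of length at least 3. The library's connectedness includes non-emptiness.
\<close>

definition undirected_tree :: "'a pair_pre_digraph \<Rightarrow> bool" where
  "undirected_tree X \<longleftrightarrow>
     pair_graph X \<and>
     Digraph_Component.connected (with_proj X) \<and>
     \<not> (\<exists>p. pre_digraph.cycle (with_proj X) p \<and> 3 \<le> length p)"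

text \<open>Rows and columns are indexed by the vertices listed in increasing order.\<close>

definition adjacency_matrix :: "'a::linorder pair_pre_digraph \<Rightarrow> complex mat" where
  "adjacency_matrix X =
     (let n = card (pverts X); vs = sorted_list_of_set (pverts X)
      in mat n n (\<lambda>(i, j). if (vs ! i, vs ! j) \<in> parcs X then 1 else 0))"

definition has_simple_eigenvalues :: "'a::linorder pair_pre_digraph \<Rightarrow> bool" where
  "has_simple_eigenvalues X \<longleftrightarrow> card (spectrum (adjacency_matrix X)) = card (pverts X)"

text \<open>For square \<open>B\<close>: the exponential series, whose convergence is entrywise.\<close>

definition matrix_exp :: "complex mat \<Rightarrow> complex mat" where
  "matrix_exp B =
     mat (dim_row B) (dim_col B) (\<lambda>(i, j). \<Sum>k. (B ^\<^sub>m k) $$ (i, j) / fact k)"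

definition transition_matrix :: "'a::linorder pair_pre_digraph \<Rightarrow> real \<Rightarrow> complex mat" where
  "transition_matrix X t = matrix_exp ((\<i> * complex_of_real t) \<cdot>\<^sub>m adjacency_matrix X)"

definition schur_product :: "complex mat \<Rightarrow> complex mat \<Rightarrow> complex mat" where
  "schur_product B C = mat (dim_row B) (dim_col B) (\<lambda>(i, j). B $$ (i, j) * C $$ (i, j))"

definition mixing_matrix :: "'a::linorder pair_pre_digraph \<Rightarrow> real \<Rightarrow> complex mat" where
  "mixing_matrix X t = schur_product (transition_matrix X t) (map_mat cnj (transition_matrix X t))"

text \<open>
  Integral and limit are entrywise. The entries are real, but are kept in the complex numbers;
  the rank of a real matrix is the same over both fields.
\<close>

definition average_mixing_matrix :: "'a::linorder pair_pre_digraph \<Rightarrow> complex mat" where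
  "average_mixing_matrix X =
     mat (card (pverts X)) (card (pverts X)) (\<lambda>(i, j).
       Lim at_top (\<lambda>T::real. complex_of_real (1 / T) *
         integral {0..T} (\<lambda>t. mixing_matrix X t $$ (i, j))))"

definition mat_rank :: "complex mat \<Rightarrow> nat" where
  "mat_rank B = vec_space.rank (dim_row B) B"

end

theory Submission
  imports Defs
begin

text \<open>
  If the adjacency matrix has simple eigenvalues with unit eigenvectors \<open>u\<^sub>a\<close>, then the average mixing
  matrix is the Gram matrix of the rows of \<open>(u\<^sub>a(i)\<^sup>2)\<close>, indexed by vertices \<open>i\<close>. Hence its rank is at most
  \<open>r\<close> whenever all squared eigenvectors satisfy common linear relations that express every coordinate
  through \<open>r\<close> fixed ones. Attaching a pendant vertex to each vertex keeps a tree a tree and its eigenvalues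
  simple, and doubles both the number \<open>n\<close> of vertices and the bound \<open>r\<close>, hence also \<open>n / 2 - r\<close>. It
  remains to find one tree with \<open>r < n / 2\<close>, and there is one with \<open>n = 18\<close> and \<open>r = 8\<close>.
\<close>

subsection \<open>Trees given by a parent function\<close>

definition parent_adj :: "(nat \<Rightarrow> nat) \<Rightarrow> nat \<Rightarrow> nat \<Rightarrow> bool" where
  "parent_adj p i j \<longleftrightarrow> i \<noteq> 0 \<and> j = p i \<or> j \<noteq> 0 \<and> i = p j"

definition parent_graph :: "nat \<Rightarrow> (nat \<Rightarrow> nat) \<Rightarrow> nat pair_pre_digraph" where
  "parent_graph n p = \<lparr>pverts = {..<n}, parcs = {(i, j). i < n \<and> j < n \<and> parent_adj p i j}\<rparr>"

lemma pverts_parent_graph [simp]: "pverts (parent_graph n p) = {..<n}"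
  and parcs_parent_graph: "(i, j) \<in> parcs (parent_graph n p) \<longleftrightarrow> i < n \<and> j < n \<and> parent_adj p i j"
  by (simp_all add: parent_graph_def)

lemma parent_adj_sym: "parent_adj p i j \<longleftrightarrow> parent_adj p j i"
  by (auto simp: parent_adj_def)

lemma pcas_nth_Suc:
  "pcas u q v \<Longrightarrow> Suc i < length q \<Longrightarrow> fst (q ! Suc i) = snd (q ! i)"
proof (induction q arbitrary: u i)
  case (Cons e q)
  then show ?case by (cases i; cases q) auto
qed simp

lemma pcas_last: "pcas u q v \<Longrightarrow> q \<noteq> [] \<Longrightarrow> snd (last q) = v"
  by (induction q arbitrary: u) auto

text \<open>Turns the distinctness condition in the definition of a cycle into distinctness of the
  arc heads, which can be indexed cyclically.\<close>

lemma tl_pawalk_verts: "pcas u q v \<Longrightarrow> tl (pawalk_verts u q) = map snd q"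
proof (induction q arbitrary: u)
  case (Cons e q)
  then show ?case by (cases q) auto
qed simp

text \<open>Parents carry smaller numbers than their children: connectedness becomes an induction
  and acyclicity a maximum argument.\<close>

locale parent_tree =
  fixes n :: nat and p :: "nat \<Rightarrow> nat"
  assumes parent_less: "\<And>i. 0 < i \<Longrightarrow> i < n \<Longrightarrow> p i < i"
begin

lemma pair_graph_parent_graph: "pair_graph (parent_graph n p)"
proof
  show "finite (parcs (parent_graph n p))"
    by (rule finite_subset[of _ "{..<n} \<times> {..<n}"]) (auto simp: parent_graph_def)
  show "symmetric (parent_graph n p)"
    by (auto simp: symmetric_def sym_def parcs_parent_graph parent_adj_sym)
  show "fst e \<noteq> snd e" if "e \<in> parcs (parent_graph n p)" for e
    using that parent_less[of "fst e"] parent_less[of "snd e"]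
    by (cases e) (auto simp: parcs_parent_graph parent_adj_def)
qed (auto simp: parcs_parent_graph)

lemma connected_parent_graph:
  assumes "0 < n"
  shows "Digraph_Component.connected (with_proj (parent_graph n p))"
proof -
  let ?G = "parent_graph n p" and ?R = "\<lambda>i j. (i, j) \<in> rtrancl_on {..<n} (parcs (parent_graph n p))"
  interpret G: pair_graph ?G by (rule pair_graph_parent_graph)
  \<comment> \<open>Both directions at once, so that any two vertices can be joined through the
    root.\<close>
  have root: "?R i 0 \<and> ?R 0 i" if "i < n" for i
    using that
  proof (induction i rule: less_induct)
    case (less i)
    show ?case
    proof (cases "i = 0")
      case False
      then have "p i < i" using parent_less less.prems by simp
      then have arcs: "(i, p i) \<in> parcs ?G" "(p i, i) \<in> parcs ?G"
        using False less.prems by (auto simp: parcs_parent_graph parent_adj_def)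
      have IH: "?R (p i) 0" "?R 0 (p i)" using less \<open>p i < i\<close> by auto
      show ?thesis
        using converse_rtrancl_on_into_rtrancl_on[OF arcs(1) IH(1)]
          rtrancl_on_into_rtrancl_on[OF IH(2) arcs(2)] less.prems by simp
    qed (use assms in simp)
  qed
  have "(i, j) \<in> rtrancl_on {..<n} ((parcs ?G)\<^sup>s)" if "i < n" "j < n" for i j
  proof (rule rtrancl_on_mono)
    show "?R i j" using root that by (blast intro: rtrancl_on_trans)
  qed (auto simp: symcl_def)
  then show ?thesis
    using assms by (auto simp: connected_conv)
qed

text \<open>The largest vertex of a cycle would have both its neighbours on the cycle equal to its parent.\<close>

lemma no_long_cycle:
  assumes "pre_digraph.cycle (with_proj (parent_graph n p)) q"
  shows "length q < 3"
proof (rule ccontr)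
  let ?G = "parent_graph n p"
  interpret G: pair_graph ?G by (rule pair_graph_parent_graph)
  assume "\<not> length q < 3"
  define L where "L = length q"
  have L: "3 \<le> L" using \<open>\<not> length q < 3\<close> by (simp add: L_def)
  obtain u where walk: "set q \<subseteq> parcs ?G" "pcas u q u" and "distinct (tl (pawalk_verts u q))"
    using assms by (auto simp: G.cycle_def G.awalk_def)
  then have dist: "distinct (map snd q)" by (simp add: tl_pawalk_verts)
  \<comment> \<open>Reading indices modulo \<open>L\<close> gives every vertex of the cycle a
    predecessor and a successor.\<close>
  define f where "f i = snd (q ! (i mod L))" for i
  have f_eq: "i mod L = j mod L" if "f i = f j" for i j
    using that L nth_eq_iff_index_eq[OF dist, of "i mod L" "j mod L"]
    by (simp add: f_def flip: L_def)
  have f_adj: "f i < n \<and> f (Suc i) < n \<and> parent_adj p (f i) (f (Suc i))" for i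
  proof -
    let ?j = "Suc i mod L"
    have "?j < L" using L by simp
    then have "q ! ?j \<in> parcs ?G" using walk(1) by (auto simp: L_def)
    moreover have "fst (q ! ?j) = f i"
    proof (cases "?j = 0")
      case True
      then have "i mod L = L - 1" using L by (metis mod_Suc diff_Suc_1 nat.distinct(1))
      then have "f i = u"
        using pcas_last[OF walk(2)] L by (cases q) (auto simp: f_def last_conv_nth L_def)
      moreover have "fst (q ! 0) = u" using walk(2) L by (cases q) (auto simp: L_def)
      ultimately show ?thesis using True by simp
    next
      case False
      then have "?j = Suc (i mod L)" by (metis mod_Suc)
      then show ?thesis
        using pcas_nth_Suc[OF walk(2), of "i mod L"] \<open>?j < L\<close> by (simp add: f_def L_def)
    qed
    ultimately show ?thesis
      by (cases "q ! ?j") (simp add: f_def parcs_parent_graph)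
  qed
  have "finite (range f)" "range f \<noteq> {}"
    using f_adj by (auto intro!: finite_subset[of _ "{..<n}"])
  then have "Max (range f) \<in> range f" by (rule Max_in)
  then obtain k where k: "Max (range f) = f k" by auto
  have max: "f i \<le> f k" for i
    using Max_ge[OF \<open>finite (range f)\<close>, of "f i"] k by simp
  \<comment> \<open>The cyclic predecessor of \<open>k\<close>; adding \<open>L\<close> first avoids
    truncated subtraction at \<open>k = 0\<close>.\<close>
  define i where "i = k + L - 1"
  have "Suc i mod L = k mod L" using L by (simp add: i_def)
  then have fi: "f (Suc i) = f k" by (simp add: f_def)
  \<comment> \<open>A neighbour that is not larger than \<open>f k\<close> cannot be its
    child.\<close>
  have parent: "j = p (f k)" if "j \<le> f k" "parent_adj p j (f k)" "j < n" for j
    using that parent_less[of j] by (auto simp: parent_adj_def)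
  have "f (Suc k) = p (f k)"
    using f_adj[of k] max parent parent_adj_sym by blast
  moreover have "f i = p (f k)"
    using f_adj[of i] max parent fi by metis
  ultimately have "Suc k mod L = i mod L" by (simp add: f_eq)
  \<comment> \<open>Together with the previous congruence, \<open>i\<close> and \<open>i + 2\<close>
    agree modulo \<open>L\<close>, which \<open>3 \<le> L\<close> forbids.\<close>
  moreover have "(i + 2) mod L = Suc k mod L"
  proof -
    have "i + 2 = Suc k + L" using L by (simp add: i_def)
    then show ?thesis by (metis mod_add_self2)
  qed
  ultimately have "L dvd i + 2 - i"
    using mod_eq_dvd_iff_nat[of i "i + 2" L] by simp
  then show False using L by (auto dest: dvd_imp_le)
qed

lemma undirected_tree_parent_graph: "0 < n \<Longrightarrow> undirected_tree (parent_graph n p)"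
  using pair_graph_parent_graph connected_parent_graph no_long_cycle
  unfolding undirected_tree_def by (meson leD)

end

subsection \<open>The average mixing matrix for simple eigenvalues\<close>

definition eigenfunction :: "nat \<Rightarrow> (nat \<Rightarrow> nat \<Rightarrow> real) \<Rightarrow> real \<Rightarrow> (nat \<Rightarrow> real) \<Rightarrow> bool" where
  "eigenfunction n A \<theta> v \<longleftrightarrow> (\<exists>i<n. v i \<noteq> 0) \<and> (\<forall>i<n. (\<Sum>j<n. A i j * v j) = \<theta> * v i)"

text \<open>Symmetry moves \<open>A\<close> from one factor of the inner product to the other, so
  \<open>\<theta>\<close> and \<open>\<eta>\<close> times that product are equal.\<close>

lemma eigenfunctions_orthogonal:
  assumes sym: "\<And>i j. A i j = A j i"
    and "eigenfunction n A \<theta> v" "eigenfunction n A \<eta> w" "\<theta> \<noteq> \<eta>"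
  shows "(\<Sum>i<n. v i * w i) = 0"
proof -
  have "\<theta> * (\<Sum>i<n. v i * w i) = (\<Sum>i<n. (\<Sum>j<n. A i j * v j) * w i)"
    using assms(2) by (simp add: eigenfunction_def sum_distrib_left mult.assoc)
  also have "\<dots> = (\<Sum>i<n. \<Sum>j<n. A i j * v j * w i)"
    by (simp add: sum_distrib_right)
  also have "\<dots> = (\<Sum>j<n. \<Sum>i<n. A i j * v j * w i)"
    by (rule sum.swap)
  also have "\<dots> = (\<Sum>j<n. v j * (\<Sum>i<n. A j i * w i))"
    by (simp add: sum_distrib_left sym[of _ j for j] mult_ac)
  also have "\<dots> = \<eta> * (\<Sum>i<n. v i * w i)"
    using assms(3) by (simp add: eigenfunction_def sum_distrib_left mult_ac)
  finally show ?thesis using \<open>\<theta> \<noteq> \<eta>\<close> by simp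
qed

text \<open>For \<open>c \<noteq> 0\<close> the integral stays bounded by
  \<open>2 / \<bar>c\<bar>\<close>, so its mean tends to zero; for \<open>c = 0\<close> the mean is
  1.\<close>

lemma average_exp_tendsto:
  fixes c :: real
  shows "((\<lambda>T::real. complex_of_real (1 / T) * integral {0..T} (\<lambda>t. exp (\<i> * complex_of_real (t * c))))
    \<longlongrightarrow> of_bool (c = 0)) at_top"
proof (cases "c = 0")
  case True
  have "\<forall>\<^sub>F T::real in at_top. complex_of_real (1 / T) * integral {0..T} (\<lambda>t. exp (\<i> * complex_of_real (t * c))) = 1"
    using eventually_gt_at_top[of 0] by eventually_elim (simp add: True scaleR_conv_of_real)
  then show ?thesis using True by (simp add: tendsto_eventually)
next
  case False
  let ?F = "\<lambda>t. exp (\<i> * complex_of_real (t * c)) / (\<i> * complex_of_real c)"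
  have int: "integral {0..T} (\<lambda>t. exp (\<i> * complex_of_real (t * c))) = ?F T - ?F 0" if "0 \<le> T" for T
  proof (rule integral_unique, rule fundamental_theorem_of_calculus[OF that])
    fix t
    have "((\<lambda>t. exp (\<i> * complex_of_real c * t) / (\<i> * complex_of_real c)) has_field_derivative
        exp (\<i> * complex_of_real c * complex_of_real t)) (at (complex_of_real t))"
      using False by (auto intro!: derivative_eq_intros)
    then have "((\<lambda>t. exp (\<i> * complex_of_real c * complex_of_real t) / (\<i> * complex_of_real c)) has_vector_derivative
        exp (\<i> * complex_of_real c * complex_of_real t)) (at t within {0..T})"
      by (rule has_vector_derivative_real_field)
    then show "(?F has_vector_derivative exp (\<i> * complex_of_real (t * c))) (at t within {0..T})"
      by (simp add: mult_ac)
  qed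
  have "((\<lambda>T::real. complex_of_real (1 / T) * integral {0..T} (\<lambda>t. exp (\<i> * complex_of_real (t * c)))) \<longlongrightarrow> 0) at_top"
  proof (rule Lim_null_comparison)
    show "\<forall>\<^sub>F T in at_top. norm (complex_of_real (1 / T) * integral {0..T} (\<lambda>t. exp (\<i> * complex_of_real (t * c))))
        \<le> 2 / \<bar>c\<bar> * inverse T"
      using eventually_gt_at_top[of 0]
    proof eventually_elim
      case (elim T)
      have "norm (?F T - ?F 0) \<le> norm (?F T) + norm (?F 0)" by (rule norm_triangle_ineq4)
      also have "\<dots> = 2 / \<bar>c\<bar>" by (simp add: norm_divide norm_mult)
      finally have "norm (?F T - ?F 0) * inverse T \<le> 2 / \<bar>c\<bar> * inverse T"
        using elim by (intro mult_right_mono) auto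
      moreover have "norm (complex_of_real (1 / T)) = inverse T"
        unfolding norm_of_real using elim by (simp add: inverse_eq_divide)
      ultimately show ?case
        unfolding int[OF less_imp_le[OF elim]] norm_mult by (simp only: mult.commute)
    qed
    show "((\<lambda>T::real. 2 / \<bar>c\<bar> * inverse T) \<longlongrightarrow> 0) at_top"
      by (intro tendsto_mult_right_zero tendsto_inverse_0_at_top filterlim_ident)
  qed
  then show ?thesis using False by simp
qed

text \<open>Real spectral data for \<open>X\<close>: as many distinct eigenvalues as vertices, with
  unit eigenfunctions. Symmetry makes these an orthonormal basis.\<close>

locale simple_real_spectrum =
  fixes X :: "'a::linorder pair_pre_digraph" and n :: nat
    and A :: "nat \<Rightarrow> nat \<Rightarrow> real" and \<theta> :: "nat \<Rightarrow> real" and u :: "nat \<Rightarrow> nat \<Rightarrow> real"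
  assumes card_verts: "card (pverts X) = n"
    and adjacency: "adjacency_matrix X = mat n n (\<lambda>(i, j). complex_of_real (A i j))"
    and sym: "\<And>i j. A i j = A j i"
    and inj: "inj_on \<theta> {..<n}"
    and eigen: "\<And>a. a < n \<Longrightarrow> eigenfunction n A (\<theta> a) (u a)"
    and unit: "\<And>a. a < n \<Longrightarrow> (\<Sum>i<n. (u a i)\<^sup>2) = 1"
begin

text \<open>The distinct values \<open>\<theta> a\<close> are eigenvalues, and an \<open>n\<close>
  by \<open>n\<close> matrix has at most \<open>n\<close> of them.\<close>

lemma simple_eigenvalues: "has_simple_eigenvalues X"
proof -
  let ?B = "adjacency_matrix X"
  have B: "?B \<in> carrier_mat n n" by (simp add: adjacency)
  have "complex_of_real (\<theta> a) \<in> spectrum ?B" if a: "a < n" for a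
  proof -
    let ?v = "vec n (\<lambda>i. complex_of_real (u a i))"
    obtain i where "i < n" "u a i \<noteq> 0" using eigen[OF a] by (auto simp: eigenfunction_def)
    then have "?v $ i \<noteq> 0\<^sub>v n $ i" by simp
    then have "?v \<noteq> 0\<^sub>v n" by metis
    moreover have "?B *\<^sub>v ?v = complex_of_real (\<theta> a) \<cdot>\<^sub>v ?v"
    proof (rule eq_vecI)
      fix i assume "i < dim_vec (complex_of_real (\<theta> a) \<cdot>\<^sub>v ?v)"
      then have "i < n" by simp
      then have "(?B *\<^sub>v ?v) $ i = complex_of_real (\<Sum>j<n. A i j * u a j)"
        by (simp add: adjacency scalar_prod_def atLeast0LessThan)
      then show "(?B *\<^sub>v ?v) $ i = (complex_of_real (\<theta> a) \<cdot>\<^sub>v ?v) $ i"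
        using eigen[OF a] \<open>i < n\<close> by (simp add: eigenfunction_def del: of_real_sum)
    qed (simp add: adjacency)
    ultimately have "eigenvector ?B ?v (complex_of_real (\<theta> a))"
      by (simp add: eigenvector_def adjacency)
    then show ?thesis by (auto simp: spectrum_def eigenvalue_def)
  qed
  then have "(complex_of_real \<circ> \<theta>) ` {..<n} \<subseteq> spectrum ?B" by auto
  then have "card ((complex_of_real \<circ> \<theta>) ` {..<n}) \<le> card (spectrum ?B)"
    by (rule card_mono[OF card_finite_spectrum(1)[OF B]])
  moreover have "card ((complex_of_real \<circ> \<theta>) ` {..<n}) = n"
    using inj by (subst card_image) (auto simp: inj_on_def)
  ultimately show ?thesis
    using card_finite_spectrum(2)[OF B] by (simp add: has_simple_eigenvalues_def card_verts)
qed

lemma orthonormal: "a < n \<Longrightarrow> b < n \<Longrightarrow> (\<Sum>i<n. u a i * u b i) = of_bool (a = b)"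
  using eigenfunctions_orthogonal[OF sym eigen eigen, of a b] unit[of a] inj
  by (auto simp: power2_eq_square inj_on_def)

text \<open>The eigenfunctions are orthonormal rows of a square matrix, and a one-sided inverse is
  two-sided, so the columns are orthonormal too.\<close>

lemma complete:
  assumes "i < n" "j < n"
  shows "(\<Sum>a<n. u a i * u a j) = of_bool (i = j)"
proof -
  define U where "U = mat n n (\<lambda>(a, i). u a i)"
  have U: "U \<in> carrier_mat n n" by (simp add: U_def)
  have "U * transpose_mat U = 1\<^sub>m n"
    by (rule eq_matI) (auto simp: U_def scalar_prod_def orthonormal atLeast0LessThan)
  then have "transpose_mat U * U = 1\<^sub>m n"
    using mat_mult_left_right_inverse[OF U] U by simp
  then have "(transpose_mat U * U) $$ (i, j) = of_bool (i = j)" using assms by simp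
  then show ?thesis using assms by (simp add: U_def scalar_prod_def atLeast0LessThan)
qed

text \<open>Spectral decomposition: completeness is the case \<open>k = 0\<close>, and each further
  factor acts on \<open>u a\<close> as \<open>z * \<theta> a\<close>.\<close>

lemma pow_smult_adjacency:
  assumes "i < n" "j < n"
  shows "((z \<cdot>\<^sub>m adjacency_matrix X) ^\<^sub>m k) $$ (i, j)
    = (\<Sum>a<n. (z * \<theta> a) ^ k * complex_of_real (u a i * u a j))"
  using assms
proof (induction k arbitrary: j)
  case 0
  then show ?case
    using complete[of i j] by (auto simp: adjacency simp flip: of_real_mult of_real_sum)
next
  case (Suc k)
  let ?B = "z \<cdot>\<^sub>m adjacency_matrix X"
  have B: "?B \<in> carrier_mat n n" by (simp add: adjacency)
  have "(?B ^\<^sub>m Suc k) $$ (i, j) = (\<Sum>l<n. (?B ^\<^sub>m k) $$ (i, l) * (z * A l j))"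
    using Suc.prems pow_carrier_mat[OF B, of k] by (simp add: scalar_prod_def adjacency atLeast0LessThan)
  also have "\<dots> = (\<Sum>l<n. \<Sum>a<n. (z * \<theta> a) ^ k * complex_of_real (u a i * u a l) * (z * A l j))"
    using Suc by (simp add: sum_distrib_right)
  also have "\<dots> = (\<Sum>a<n. \<Sum>l<n. (z * \<theta> a) ^ k * complex_of_real (u a i * u a l) * (z * A l j))"
    by (rule sum.swap)
  also have "\<dots> = (\<Sum>a<n. (z * \<theta> a) ^ k * z * complex_of_real (u a i) * complex_of_real (\<Sum>l<n. A j l * u a l))"
    by (simp add: sum_distrib_left mult_ac sym[of _ j])
  also have "\<dots> = (\<Sum>a<n. (z * \<theta> a) ^ Suc k * complex_of_real (u a i * u a j))"
    using eigen Suc.prems by (intro sum.cong) (simp_all add: eigenfunction_def mult_ac)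
  finally show ?case .
qed

lemma transition_matrix_entry:
  assumes "i < n" "j < n"
  shows "transition_matrix X t $$ (i, j)
    = (\<Sum>a<n. exp (\<i> * complex_of_real (t * \<theta> a)) * complex_of_real (u a i * u a j))"
proof -
  let ?z = "\<i> * complex_of_real t"
  have "(\<lambda>k. \<Sum>a<n. (?z * \<theta> a) ^ k /\<^sub>R fact k * complex_of_real (u a i * u a j))
      sums (\<Sum>a<n. exp (?z * \<theta> a) * complex_of_real (u a i * u a j))"
    by (intro sums_sum sums_mult2 exp_converges)
  then have "(\<lambda>k. ((?z \<cdot>\<^sub>m adjacency_matrix X) ^\<^sub>m k) $$ (i, j) / fact k)
      sums (\<Sum>a<n. exp (?z * \<theta> a) * complex_of_real (u a i * u a j))"
    by (simp add: pow_smult_adjacency assms sum_divide_distrib scaleR_conv_of_real field_simps)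
  then show ?thesis
    using assms by (simp add: transition_matrix_def matrix_exp_def adjacency sums_iff mult.assoc)
qed

text \<open>Multiplying by the conjugate leaves phases that depend only on differences of
  eigenvalues.\<close>

lemma mixing_matrix_entry:
  assumes "i < n" "j < n"
  shows "mixing_matrix X t $$ (i, j) = (\<Sum>a<n. \<Sum>b<n.
    complex_of_real (u a i * u a j * (u b i * u b j)) * exp (\<i> * complex_of_real (t * (\<theta> a - \<theta> b))))"
proof -
  have "dim_row (transition_matrix X t) = n" "dim_col (transition_matrix X t) = n"
    by (simp_all add: transition_matrix_def matrix_exp_def adjacency)
  then have "mixing_matrix X t $$ (i, j) = transition_matrix X t $$ (i, j) * cnj (transition_matrix X t $$ (i, j))"
    using assms by (simp add: mixing_matrix_def schur_product_def)
  also have "\<dots> = (\<Sum>a<n. \<Sum>b<n.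
    complex_of_real (u a i * u a j * (u b i * u b j)) * exp (\<i> * complex_of_real (t * (\<theta> a - \<theta> b))))"
    by (simp add: transition_matrix_entry assms sum_product exp_cnj exp_diff right_diff_distrib
        exp_minus divide_inverse mult_ac)
  finally show ?thesis .
qed

text \<open>Averaging keeps only the pairs with \<open>\<theta> a = \<theta> b\<close>; injectivity
  of \<open>\<theta>\<close> reduces these to \<open>a = b\<close>.\<close>

lemma average_mixing_matrix_eq:
  "average_mixing_matrix X = mat n n (\<lambda>(i, j). complex_of_real (\<Sum>a<n. (u a i)\<^sup>2 * (u a j)\<^sup>2))"
proof -
  have "((\<lambda>T::real. complex_of_real (1 / T) * integral {0..T} (\<lambda>t. mixing_matrix X t $$ (i, j)))
      \<longlongrightarrow> complex_of_real (\<Sum>a<n. (u a i)\<^sup>2 * (u a j)\<^sup>2)) at_top" if ij: "i < n" "j < n" for i j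
  proof -
    let ?g = "\<lambda>a b. complex_of_real (u a i * u a j * (u b i * u b j))"
    let ?e = "\<lambda>a b t. exp (\<i> * complex_of_real (t * (\<theta> a - \<theta> b)))"
    have int: "(?e a b) integrable_on {0..T}" for a b T
      by (intro integrable_continuous_interval continuous_intros)
    have "complex_of_real (1 / T) * integral {0..T} (\<lambda>t. mixing_matrix X t $$ (i, j))
        = (\<Sum>a<n. \<Sum>b<n. ?g a b * (complex_of_real (1 / T) * integral {0..T} (?e a b)))" for T
    proof -
      have "integral {0..T} (\<lambda>t. mixing_matrix X t $$ (i, j))
          = (\<Sum>a<n. \<Sum>b<n. integral {0..T} (\<lambda>t. ?g a b * ?e a b t))"
        unfolding mixing_matrix_entry[OF ij]
        by (subst integral_sum, simp, (intro integrable_sum integrable_on_mult_right int finite_lessThan)[1])+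
          simp
      then show ?thesis by (simp add: sum_distrib_left mult_ac)
    qed
    moreover have "((\<lambda>T. \<Sum>a<n. \<Sum>b<n. ?g a b * (complex_of_real (1 / T) * integral {0..T} (?e a b)))
        \<longlongrightarrow> (\<Sum>a<n. \<Sum>b<n. ?g a b * of_bool (\<theta> a - \<theta> b = 0))) at_top"
      by (intro tendsto_sum tendsto_mult_left average_exp_tendsto)
    moreover have "(\<Sum>a<n. \<Sum>b<n. ?g a b * of_bool (\<theta> a - \<theta> b = 0)) = complex_of_real (\<Sum>a<n. (u a i)\<^sup>2 * (u a j)\<^sup>2)"
    proof -
      have "(\<Sum>b<n. ?g a b * of_bool (\<theta> a - \<theta> b = 0)) = complex_of_real ((u a i)\<^sup>2 * (u a j)\<^sup>2)"
        if "a < n" for a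
      proof -
        have "(\<Sum>b<n. ?g a b * of_bool (\<theta> a - \<theta> b = 0)) = (\<Sum>b<n. if b = a then ?g a b else 0)"
          using that inj by (intro sum.cong) (auto simp: inj_on_def)
        also have "\<dots> = ?g a a" using that by simp
        finally show ?thesis by (simp add: power2_eq_square mult_ac)
      qed
      then show ?thesis by simp
    qed
    ultimately show ?thesis by simp
  qed
  then show ?thesis
    unfolding average_mixing_matrix_def card_verts
    by (intro cong_mat) (auto intro!: tendsto_Lim)
qed

end

section \<open>Rank bounds from linear relations between squared eigenvectors\<close>

text \<open>A sum of \<open>card J\<close> matrices of rank at most one, by subadditivity of the
  rank.\<close>

lemma rank_factorization_le:
  fixes f g :: "'b \<Rightarrow> nat \<Rightarrow> 'a::field"
  assumes "finite J"
  shows "vec_space.rank n (mat n nc (\<lambda>(i, k). \<Sum>j\<in>J. f j i * g j k)) \<le> card J"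
  using assms
proof induction
  case empty
  have "mat n nc (\<lambda>_. 0) = (0\<^sub>m n nc :: 'a mat)" by (rule eq_matI) auto
  then show ?case by (simp add: vec_space.rank_0I)
next
  case (insert x J)
  let ?P = "mat n nc (\<lambda>(i, k). f x i * g x k)" and ?Q = "mat n nc (\<lambda>(i, k). \<Sum>j\<in>J. f j i * g j k)"
  have "mat n nc (\<lambda>(i, k). \<Sum>j\<in>insert x J. f j i * g j k) = ?P + ?Q"
    using insert.hyps by (intro eq_matI) auto
  moreover have "vec_space.rank n (?P + ?Q) \<le> vec_space.rank n ?P + vec_space.rank n ?Q"
    by (rule vec_space.rank_subadditive) auto
  moreover have "vec_space.rank n ?P \<le> 1"
    by (rule vec_space.rank_le_1_product_entries[of _ _ nc "f x" "g x"]) auto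
  ultimately show ?case using insert by simp
qed

text \<open>A linear relation shared by all squared eigenvectors passes to the rows of their Gram
  matrix, which therefore factors through \<open>J\<close>.\<close>

lemma (in simple_real_spectrum) rank_average_mixing_matrix_le:
  assumes "finite J"
    and dep: "\<And>a i. a < n \<Longrightarrow> i < n \<Longrightarrow> (u a i)\<^sup>2 = (\<Sum>j\<in>J. c i j * (u a j)\<^sup>2)"
  shows "mat_rank (average_mixing_matrix X) \<le> card J"
proof -
  have "(\<Sum>a<n. (u a i)\<^sup>2 * (u a k)\<^sup>2) = (\<Sum>j\<in>J. c i j * (\<Sum>a<n. (u a j)\<^sup>2 * (u a k)\<^sup>2))"
    if "i < n" for i k
  proof -
    have "(\<Sum>a<n. (u a i)\<^sup>2 * (u a k)\<^sup>2) = (\<Sum>a<n. \<Sum>j\<in>J. c i j * (u a j)\<^sup>2 * (u a k)\<^sup>2)"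
      using dep that by (simp add: sum_distrib_right)
    also have "\<dots> = (\<Sum>j\<in>J. \<Sum>a<n. c i j * (u a j)\<^sup>2 * (u a k)\<^sup>2)" by (rule sum.swap)
    finally show ?thesis by (simp add: sum_distrib_left mult.assoc)
  qed
  then have "average_mixing_matrix X
      = mat n n (\<lambda>(i, k). \<Sum>j\<in>J. complex_of_real (c i j) * complex_of_real (\<Sum>a<n. (u a j)\<^sup>2 * (u a k)\<^sup>2))"
    unfolding average_mixing_matrix_eq by (intro cong_mat) (simp_all flip: of_real_mult of_real_sum)
  then show ?thesis
    using rank_factorization_le[OF \<open>finite J\<close>, of n n "\<lambda>j i. complex_of_real (c i j)"
        "\<lambda>j k. complex_of_real (\<Sum>a<n. (u a j)\<^sup>2 * (u a k)\<^sup>2)"]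
    by (simp add: mat_rank_def)
qed

lemma adjacency_matrix_parent_graph:
  "adjacency_matrix (parent_graph n p)
    = mat n n (\<lambda>(i, j). complex_of_real (of_bool (parent_adj p i j)))"
proof -
  have "sorted_list_of_set {..<n} = [0..<n]"
    by (metis atLeast_upt sorted_list_of_set_range atLeast0LessThan)
  then show ?thesis
    by (auto simp: adjacency_matrix_def parcs_parent_graph Let_def intro!: cong_mat)
qed

text \<open>The invariant of the construction. The coefficients \<open>c\<close> are chosen before
  \<open>\<theta>\<close>, hence common to all eigenvectors; the relations are homogeneous, so these
  may have any length.\<close>

definition low_square_rank :: "nat \<Rightarrow> (nat \<Rightarrow> nat \<Rightarrow> real) \<Rightarrow> nat \<Rightarrow> bool" where
  "low_square_rank n A r \<longleftrightarrow> (\<exists>\<Theta> J c. card \<Theta> = n \<and> finite \<Theta> \<and> card J = r \<and> J \<subseteq> {..<n} \<and>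
     (\<forall>\<theta>\<in>\<Theta>. \<exists>v. eigenfunction n A \<theta> v \<and> (\<forall>i<n. (v i)\<^sup>2 = (\<Sum>j\<in>J. c i j * (v j)\<^sup>2))))"

lemma low_square_rankI:
  assumes "card \<Theta> = n" "finite \<Theta>" "card J = r" "J \<subseteq> {..<n}"
    and "\<And>\<theta>. \<theta> \<in> \<Theta> \<Longrightarrow> \<exists>v. eigenfunction n A \<theta> v \<and> (\<forall>i<n. (v i)\<^sup>2 = (\<Sum>j\<in>J. c i j * (v j)\<^sup>2))"
  shows "low_square_rank n A r"
  unfolding low_square_rank_def using assms by blast

text \<open>Normalising an eigenfunction divides both sides of each relation by the same
  \<open>N a\<close>, so the rank bound for unit eigenfunctions applies.\<close>

lemma low_square_rankD:
  fixes X :: "'a::linorder pair_pre_digraph"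
  assumes "low_square_rank n A r" and "card (pverts X) = n"
    and "adjacency_matrix X = mat n n (\<lambda>(i, j). complex_of_real (A i j))"
    and "\<And>i j. A i j = A j i"
  shows "has_simple_eigenvalues X" "mat_rank (average_mixing_matrix X) \<le> r"
proof -
  obtain \<Theta> J c where \<Theta>: "card \<Theta> = n" "finite \<Theta>" and J: "card J = r" "J \<subseteq> {..<n}"
    and "\<forall>\<theta>\<in>\<Theta>. \<exists>v. eigenfunction n A \<theta> v \<and> (\<forall>i<n. (v i)\<^sup>2 = (\<Sum>j\<in>J. c i j * (v j)\<^sup>2))"
    using assms(1) unfolding low_square_rank_def by metis
  then obtain v where eig: "\<And>\<theta>. \<theta> \<in> \<Theta> \<Longrightarrow> eigenfunction n A \<theta> (v \<theta>)"
    and dep: "\<And>\<theta> i. \<theta> \<in> \<Theta> \<Longrightarrow> i < n \<Longrightarrow> (v \<theta> i)\<^sup>2 = (\<Sum>j\<in>J. c i j * (v \<theta> j)\<^sup>2)"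
    by metis
  obtain \<theta> where "bij_betw \<theta> {..<n} \<Theta>"
    using ex_bij_betw_nat_finite[OF \<Theta>(2)] \<Theta>(1) by (auto simp: atLeast0LessThan)
  then have inj: "inj_on \<theta> {..<n}" and \<theta>: "\<And>a. a < n \<Longrightarrow> \<theta> a \<in> \<Theta>"
    by (auto simp: bij_betw_def)
  define N where "N a = (\<Sum>i<n. (v (\<theta> a) i)\<^sup>2)" for a
  define u where "u a i = v (\<theta> a) i / sqrt (N a)" for a i
  have N: "0 < N a" if "a < n" for a
    unfolding N_def using eig[OF \<theta>[OF that]] by (auto simp: eigenfunction_def intro!: sum_pos2)
  interpret simple_real_spectrum X n A \<theta> u
  proof
    fix a assume a: "a < n"
    show "eigenfunction n A (\<theta> a) (u a)"
      using eig[OF \<theta>[OF a]] N[OF a]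
      by (auto simp: eigenfunction_def u_def simp flip: sum_divide_distrib)
    show "(\<Sum>i<n. (u a i)\<^sup>2) = 1"
      using N[OF a] by (simp add: u_def power_divide flip: sum_divide_distrib) (simp add: N_def)
  qed (use assms inj in auto)
  show "has_simple_eigenvalues X" by (rule simple_eigenvalues)
  have "mat_rank (average_mixing_matrix X) \<le> card J"
  proof (rule rank_average_mixing_matrix_le)
    show "finite J" using J(2) finite_subset by blast
    show "(u a i)\<^sup>2 = (\<Sum>j\<in>J. c i j * (u a j)\<^sup>2)" if "a < n" "i < n" for a i
      using dep[OF \<theta>] that by (simp add: u_def power_divide sum_divide_distrib)
  qed
  then show "mat_rank (average_mixing_matrix X) \<le> r" by (simp add: J(1))
qed

subsection \<open>Attaching a pendant vertex to every vertex\<close>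

text \<open>Corona product with a single vertex: \<open>i + n\<close> is the pendant at
  \<open>i\<close>. On indices below \<open>2 * n\<close> the blocks are \<open>A\<close>, two
  identities and zero.\<close>

definition corona :: "nat \<Rightarrow> (nat \<Rightarrow> nat \<Rightarrow> real) \<Rightarrow> nat \<Rightarrow> nat \<Rightarrow> real" where
  "corona n A i j = (if i < n \<and> j < n then A i j else of_bool (j = i + n \<or> i = j + n))"

lemma low_square_rank_cong:
  assumes "\<And>i j. i < n \<Longrightarrow> j < n \<Longrightarrow> A i j = B i j" "low_square_rank n A r"
  shows "low_square_rank n B r"
proof -
  have "(\<Sum>j<n. A i j * v j) = (\<Sum>j<n. B i j * v j)" if "i < n" for i v
    using assms(1) that by (intro sum.cong) auto
  then have "eigenfunction n A = eigenfunction n B"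
    by (auto simp: eigenfunction_def fun_eq_iff)
  then show ?thesis using assms(2) by (simp add: low_square_rank_def)
qed

lemma sum_lessThan_double:
  fixes f :: "nat \<Rightarrow> 'b::comm_monoid_add"
  shows "(\<Sum>j<2 * n. f j) = (\<Sum>j<n. f j) + (\<Sum>j<n. f (j + n))"
proof -
  have "(\<Sum>j<2 * n. f j) = (\<Sum>j<n. f j) + (\<Sum>j=n..<n + n. f j)"
    by (simp add: mult_2 lessThan_atLeast0 sum.atLeastLessThan_concat)
  then show ?thesis
    by (simp add: sum.shift_bounds_nat_ivl[of f 0 n n, simplified] lessThan_atLeast0)
qed

text \<open>At a pendant vertex the equation holds automatically; at an old vertex it is the
  quadratic for \<open>\<mu>\<close> times \<open>v i\<close>.\<close>

lemma eigenfunction_corona: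
  assumes eig: "eigenfunction n A \<theta> v" and "\<mu>\<^sup>2 = \<theta> * \<mu> + 1"
  shows "eigenfunction (2 * n) (corona n A) \<mu> (\<lambda>i. if i < n then \<mu> * v i else v (i - n))"
    (is "eigenfunction _ _ _ ?w")
  unfolding eigenfunction_def
proof (intro conjI allI impI)
  obtain i where "i < n" "v i \<noteq> 0" using eig by (auto simp: eigenfunction_def)
  then show "\<exists>i<2 * n. ?w i \<noteq> 0" by (intro exI[of _ "i + n"]) simp
next
  fix i assume "i < 2 * n"
  show "(\<Sum>j<2 * n. corona n A i j * ?w j) = \<mu> * ?w i"
  proof (cases "i < n")
    case True
    have "(\<Sum>j<2 * n. corona n A i j * ?w j) = (\<Sum>j<n. \<mu> * (A i j * v j)) + (\<Sum>j<n. of_bool (j = i) * v j)"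
      unfolding sum_lessThan_double using True
      by (intro arg_cong2[where f = "(+)"] sum.cong) (auto simp: corona_def)
    also have "\<dots> = \<mu> * (\<theta> * v i) + v i"
      using eig True by (simp add: eigenfunction_def flip: sum_distrib_left)
    also have "\<dots> = \<mu>\<^sup>2 * v i" using assms(2) by (simp add: algebra_simps)
    finally show ?thesis using True by (simp add: power2_eq_square)
  next
    case False
    have "(\<Sum>j<2 * n. corona n A i j * ?w j) = (\<Sum>j<n. of_bool (j = i - n) * (\<mu> * v j)) + (\<Sum>j<n. 0)"
      unfolding sum_lessThan_double using False \<open>i < 2 * n\<close>
      by (intro arg_cong2[where f = "(+)"] sum.cong) (auto simp: corona_def)
    then show ?thesis using False \<open>i < 2 * n\<close> by simp
  qed
qed

text \<open>
  Each eigenvalue \<open>\<theta>\<close> splits into the two roots \<open>\<mu>\<close> of \<open>\<mu> - 1 / \<mu> = \<theta>\<close>, which have opposite signs,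
  and the eigenfunction for \<open>\<mu>\<close> is \<open>\<mu> * v\<close> on the old vertices and \<open>v\<close> on the new ones. The linear
  relations between the squares therefore hold on both copies separately.
\<close>

lemma low_square_rank_corona:
  assumes "low_square_rank n A r"
  shows "low_square_rank (2 * n) (corona n A) (2 * r)"
proof -
  obtain \<Theta> J c where \<Theta>: "card \<Theta> = n" "finite \<Theta>" and J: "card J = r" "J \<subseteq> {..<n}"
    and ex: "\<And>\<theta>. \<theta> \<in> \<Theta> \<Longrightarrow> \<exists>v. eigenfunction n A \<theta> v \<and> (\<forall>i<n. (v i)\<^sup>2 = (\<Sum>j\<in>J. c i j * (v j)\<^sup>2))"
    using assms unfolding low_square_rank_def by metis
  define R where "R \<theta> = sqrt (\<theta>\<^sup>2 + 4)" for \<theta> :: real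
  define f where "f \<theta> = (\<theta> + R \<theta>) / 2" for \<theta> :: real
  define g where "g \<theta> = (\<theta> - R \<theta>) / 2" for \<theta> :: real
  have R2: "(R \<theta>)\<^sup>2 = \<theta>\<^sup>2 + 4" for \<theta>
    unfolding R_def by (rule real_sqrt_pow2) (simp add: add_nonneg_nonneg)
  have R_gt: "\<bar>\<theta>\<bar> < R \<theta>" for \<theta>
    unfolding R_def by (rule real_less_rsqrt) simp
  have f_eq: "(f \<theta>)\<^sup>2 = \<theta> * f \<theta> + 1" and g_eq: "(g \<theta>)\<^sup>2 = \<theta> * g \<theta> + 1" for \<theta>
    using R2[of \<theta>] by (simp_all add: f_def g_def power2_eq_square field_simps)
  have f_pos: "0 < f \<theta>" and g_neg: "g \<theta> < 0" for \<theta>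
    using R_gt[of \<theta>] by (auto simp: f_def g_def)
  \<comment> \<open>The quadratic excludes \<open>\<mu> = 0\<close>, so a root determines
    \<open>\<theta>\<close>.\<close>
  have root_inj: "\<theta> = \<eta>" if "\<mu>\<^sup>2 = \<theta> * \<mu> + 1" "\<mu>\<^sup>2 = \<eta> * \<mu> + 1" for \<theta> \<eta> \<mu> :: real
    using that by (cases "\<mu> = 0") auto
  have inj: "inj_on f \<Theta>" "inj_on g \<Theta>"
    by (auto intro!: inj_onI) (metis f_eq root_inj, metis g_eq root_inj)
  have "f \<theta> \<noteq> g \<eta>" for \<theta> \<eta>
    using f_pos[of \<theta>] g_neg[of \<eta>] by simp
  then have disj: "f ` \<Theta> \<inter> g ` \<Theta> = {}" by auto
  have card\<Theta>: "card (f ` \<Theta> \<union> g ` \<Theta>) = 2 * n"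
    using \<Theta> by (simp add: card_Un_disjoint[OF _ _ disj] card_image inj)
  let ?h = "\<lambda>j. j + n"
  have disjJ: "J \<inter> ?h ` J = {}" using J(2) by auto
  have finJ: "finite J" using J(2) finite_subset by blast
  have cardJ: "card (J \<union> ?h ` J) = 2 * r"
    using finJ J(1) by (simp add: card_Un_disjoint[OF _ _ disjJ] card_image)
  \<comment> \<open>Block-diagonal coefficients: no relation mixes old vertices with
    pendants.\<close>
  define c' where "c' i j = (if i < n \<and> j < n then c i j
    else if \<not> i < n \<and> \<not> j < n then c (i - n) (j - n) else 0)" for i j
  have "\<exists>w. eigenfunction (2 * n) (corona n A) \<mu> w \<and>
      (\<forall>i<2 * n. (w i)\<^sup>2 = (\<Sum>j\<in>J \<union> ?h ` J. c' i j * (w j)\<^sup>2))"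
    if "\<mu> \<in> f ` \<Theta> \<union> g ` \<Theta>" for \<mu>
  proof -
    obtain \<theta> where "\<theta> \<in> \<Theta>" and \<mu>: "\<mu>\<^sup>2 = \<theta> * \<mu> + 1"
      using \<open>\<mu> \<in> _\<close> f_eq g_eq by auto
    then obtain v where eig: "eigenfunction n A \<theta> v"
      and dep: "\<And>i. i < n \<Longrightarrow> (v i)\<^sup>2 = (\<Sum>j\<in>J. c i j * (v j)\<^sup>2)"
      using ex by blast
    let ?w = "\<lambda>i. if i < n then \<mu> * v i else v (i - n)"
    have J_less: "j < n" if "j \<in> J" for j using J(2) that by auto
    have "(?w i)\<^sup>2 = (\<Sum>j\<in>J \<union> ?h ` J. c' i j * (?w j)\<^sup>2)" if "i < 2 * n" for i
    proof -
      have "(\<Sum>j\<in>J \<union> ?h ` J. c' i j * (?w j)\<^sup>2)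
          = (\<Sum>j\<in>J. c' i j * (?w j)\<^sup>2) + (\<Sum>j\<in>J. c' i (j + n) * (?w (j + n))\<^sup>2)"
        using finJ by (simp add: sum.union_disjoint[OF _ _ disjJ] sum.reindex)
      also have "\<dots> = (\<Sum>j\<in>J. if i < n then \<mu>\<^sup>2 * (c i j * (v j)\<^sup>2) else 0)
          + (\<Sum>j\<in>J. if i < n then 0 else c (i - n) j * (v j)\<^sup>2)"
        by (intro arg_cong2[where f = "(+)"] sum.cong)
          (auto simp: c'_def J_less power_mult_distrib)
      also have "\<dots> = (?w i)\<^sup>2"
        using dep[of i] dep[of "i - n"] that
        by (simp add: power_mult_distrib flip: sum_distrib_left)
      finally show ?thesis by simp
    qed
    then show ?thesis using eigenfunction_corona[OF eig \<mu>] by blast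
  qed
  moreover have "J \<union> ?h ` J \<subseteq> {..<2 * n}" using J(2) by auto
  ultimately show ?thesis
    using card\<Theta> cardJ \<Theta>(2)
    by (intro low_square_rankI[of "f ` \<Theta> \<union> g ` \<Theta>" _ "J \<union> ?h ` J" _ _ c']) simp_all
qed

text \<open>Pendants are numbered after all old vertices, so parents still precede their
  children.\<close>

definition corona_parent :: "nat \<Rightarrow> (nat \<Rightarrow> nat) \<Rightarrow> nat \<Rightarrow> nat" where
  "corona_parent n p i = (if i < n then p i else i - n)"

text \<open>Links the matrix construction to the tree: parents of old vertices stay below
  \<open>n\<close>, so an old vertex meets a pendant only as its parent.\<close>

lemma of_bool_parent_adj_corona:
  assumes "parent_tree n p" "0 < n" "i < 2 * n" "j < 2 * n"
  shows "corona n (\<lambda>i j. of_bool (parent_adj p i j)) i j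
    = of_bool (parent_adj (corona_parent n p) i j)"
proof -
  have "p k < n" if "k < n" "k \<noteq> 0" for k
    using parent_tree.parent_less[OF assms(1), of k] that by simp
  from this[of i] this[of j] show ?thesis
    using assms(2-4) by (cases "i < n"; cases "j < n") (auto simp: corona_def parent_adj_def corona_parent_def)
qed

lemma parent_tree_corona: "parent_tree n p \<Longrightarrow> 0 < n \<Longrightarrow> parent_tree (2 * n) (corona_parent n p)"
  by (auto simp: parent_tree_def corona_parent_def)

text \<open>Order and rank bound double together, so a positive gap \<open>n / 2 - r\<close> grows
  like \<open>2 ^ k\<close>.\<close>

lemma iterated_corona:
  assumes "parent_tree n p" "0 < n" "low_square_rank n (\<lambda>i j. of_bool (parent_adj p i j)) r"
  shows "\<exists>q. parent_tree (2 ^ k * n) q \<and>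
    low_square_rank (2 ^ k * n) (\<lambda>i j. of_bool (parent_adj q i j)) (2 ^ k * r)"
proof (induction k)
  case 0
  then show ?case using assms by auto
next
  case (Suc k)
  let ?m = "2 ^ k * n"
  obtain q where q: "parent_tree ?m q"
    "low_square_rank ?m (\<lambda>i j. of_bool (parent_adj q i j)) (2 ^ k * r)"
    using Suc by blast
  have "0 < ?m" using assms(2) by simp
  have "low_square_rank (2 * ?m) (\<lambda>i j. of_bool (parent_adj (corona_parent ?m q) i j)) (2 * (2 ^ k * r))"
    using low_square_rank_cong[OF of_bool_parent_adj_corona[OF q(1) \<open>0 < ?m\<close>] low_square_rank_corona[OF q(2)]] .
  then show ?case
    using parent_tree_corona[OF q(1) \<open>0 < ?m\<close>] by (auto simp: mult.assoc)
qed

subsection \<open>The seed tree\<close>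

text \<open>
  The seed was found by a computer search through all trees on at most 18 vertices. Its characteristic
  polynomial is \<open>(y - 1) (y\<^sup>2 - 3 y + 1) (y\<^sup>3 - 5 y\<^sup>2 + 6 y - 1) (y\<^sup>3 - 8 y\<^sup>2 + 12 y - 1)\<close> with \<open>y = x\<^sup>2\<close>. The
  first two factors come from eigenvectors that are antisymmetric under swapping the two branches on
  \<open>{5, 6}\<close> and \<open>{7, 8}\<close>, respectively the branches on \<open>{9..12}\<close> and \<open>{13..16}\<close>.
\<close>

definition seed_parent :: "nat \<Rightarrow> nat" where
  "seed_parent i = [0, 0, 1, 2, 3, 1, 5, 1, 7, 0, 9, 10, 11, 0, 13, 14, 15, 0] ! i"

lemma All_less_18: "(\<forall>i<18. P i) \<longleftrightarrow> P 0 \<and> P 1 \<and> P 2 \<and> P 3 \<and> P 4 \<and> P 5 \<and> P 6 \<and> P 7 \<and> P 8 \<and> P 9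
    \<and> P 10 \<and> P 11 \<and> P 12 \<and> P 13 \<and> P 14 \<and> P 15 \<and> P 16 \<and> P (17::nat)"
  by (simp add: numeral_eq_Suc All_less_Suc conj_ac)

lemma sum_less_18: "(\<Sum>i<18. f i) = f 0 + f 1 + f 2 + f 3 + f 4 + f 5 + f 6 + f 7 + f 8 + f 9
    + f 10 + f 11 + f 12 + f 13 + f 14 + f 15 + f 16 + f (17::nat)"
  for f :: "nat \<Rightarrow> real"
  by (simp add: numeral_eq_Suc add.assoc)

lemma parent_tree_seed: "parent_tree 18 seed_parent"
proof -
  have "\<forall>i<18. 0 < i \<longrightarrow> seed_parent i < i"
    unfolding All_less_18 by (simp add: seed_parent_def)
  then show ?thesis by (simp add: parent_tree_def)
qed

text \<open>One equation per vertex. Vertex 0 carries the leaf 17 and two paths on four vertices;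
  its neighbour 1 carries one path on three vertices and two on two.\<close>

lemma eigenfunction_seed:
  fixes v :: "nat \<Rightarrow> real"
  shows "eigenfunction 18 (\<lambda>i j. of_bool (parent_adj seed_parent i j)) \<theta> v \<longleftrightarrow>
    (\<exists>i<18. v i \<noteq> 0) \<and>
    v 1 + v 9 + v 13 + v 17 = \<theta> * v 0 \<and> v 0 + v 2 + v 5 + v 7 = \<theta> * v 1 \<and>
    v 1 + v 3 = \<theta> * v 2 \<and> v 2 + v 4 = \<theta> * v 3 \<and> v 3 = \<theta> * v 4 \<and>
    v 1 + v 6 = \<theta> * v 5 \<and> v 5 = \<theta> * v 6 \<and> v 1 + v 8 = \<theta> * v 7 \<and> v 7 = \<theta> * v 8 \<and>
    v 0 + v 10 = \<theta> * v 9 \<and> v 9 + v 11 = \<theta> * v 10 \<and> v 10 + v 12 = \<theta> * v 11 \<and> v 11 = \<theta> * v 12 \<and>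
    v 0 + v 14 = \<theta> * v 13 \<and> v 13 + v 15 = \<theta> * v 14 \<and> v 14 + v 16 = \<theta> * v 15 \<and> v 15 = \<theta> * v 16 \<and>
    v 0 = \<theta> * v 17"
  unfolding eigenfunction_def All_less_18 sum_less_18 by (simp add: parent_adj_def seed_parent_def)


text \<open>
  Value at vertex \<open>i\<close> of a squared eigenvector \<open>s\<close>, expressed through its values at \<open>0, 1, 3, 4, 6, 11, 12, 17\<close>.
\<close>

definition seed_relation :: "nat \<Rightarrow> (nat \<Rightarrow> real) \<Rightarrow> real" where
  "seed_relation i s = [s 0, s 1, s 1 - s 0 + s 3 - s 4 + s 17, s 3, s 4,
     s 3 - 2 * s 4 + s 6 + s 17, s 6, s 3 - 2 * s 4 + s 6 + s 17, s 6,
     s 1 - s 0 + s 3 - 2 * s 4 + s 12 + s 17, s 1 - s 0 + s 11, s 11, s 12,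
     s 1 - s 0 + s 3 - 2 * s 4 + s 12 + s 17, s 1 - s 0 + s 11, s 11, s 12, s 17] ! i"

text \<open>By linearity in \<open>s\<close>, the values at indicator functions are the coefficients
  that \<open>low_square_rank\<close> asks for.\<close>

lemma seed_relation_eq_sum:
  "\<forall>i<18. seed_relation i s
    = (\<Sum>j\<in>{0, 1, 3, 4, 6, 11, 12, 17}. seed_relation i (\<lambda>k. of_bool (k = j)) * s j)"
  unfolding All_less_18 by (simp add: seed_relation_def)

definition seed_eigenvalue :: "real \<Rightarrow> bool" where
  "seed_eigenvalue \<theta> \<longleftrightarrow> (\<exists>v. eigenfunction 18 (\<lambda>i j. of_bool (parent_adj seed_parent i j)) \<theta> v \<and>
     (\<forall>i<18. (v i)\<^sup>2 = seed_relation i (\<lambda>j. (v j)\<^sup>2)))"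

text \<open>The letters are the values at vertices 0 to 17 in order. Squares on mirrored branches
  are asked to agree, which leaves proper relations only at vertices 2, 5, 9 and 10.\<close>

lemma seed_eigenvalueI:
  fixes a b c d e f g h k l m n p q r s t u :: real
  assumes "g \<noteq> 0 \<or> p \<noteq> 0"
    and "b + l + q + u = \<theta> * a" "a + c + f + h = \<theta> * b"
    and "b + d = \<theta> * c" "c + e = \<theta> * d" "d = \<theta> * e"
    and "b + g = \<theta> * f" "f = \<theta> * g" "b + k = \<theta> * h" "h = \<theta> * k"
    and "a + m = \<theta> * l" "l + n = \<theta> * m" "m + p = \<theta> * n" "n = \<theta> * p"
    and "a + r = \<theta> * q" "q + s = \<theta> * r" "r + t = \<theta> * s" "s = \<theta> * t"
    and "a = \<theta> * u"
    and "c\<^sup>2 = b\<^sup>2 - a\<^sup>2 + d\<^sup>2 - e\<^sup>2 + u\<^sup>2" "f\<^sup>2 = d\<^sup>2 - 2 * e\<^sup>2 + g\<^sup>2 + u\<^sup>2"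
    and "l\<^sup>2 = b\<^sup>2 - a\<^sup>2 + d\<^sup>2 - 2 * e\<^sup>2 + p\<^sup>2 + u\<^sup>2" "m\<^sup>2 = b\<^sup>2 - a\<^sup>2 + n\<^sup>2"
    and "h\<^sup>2 = f\<^sup>2" "k\<^sup>2 = g\<^sup>2"
    and "q\<^sup>2 = l\<^sup>2" "r\<^sup>2 = m\<^sup>2" "s\<^sup>2 = n\<^sup>2" "t\<^sup>2 = p\<^sup>2"
  shows "seed_eigenvalue \<theta>"
proof -
  define v where "v i = [a, b, c, d, e, f, g, h, k, l, m, n, p, q, r, s, t, u] ! i" for i
  have v: "v 0 = a" "v 1 = b" "v 2 = c" "v 3 = d" "v 4 = e" "v 5 = f" "v 6 = g" "v 7 = h" "v 8 = k"
    "v 9 = l" "v 10 = m" "v 11 = n" "v 12 = p" "v 13 = q" "v 14 = r" "v 15 = s" "v 16 = t" "v 17 = u"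
    by (simp_all add: v_def)
  have "\<exists>i<18. v i \<noteq> 0"
    using assms(1) v(7) v(13) by (cases "g = 0") (auto intro: exI[of _ 6] exI[of _ 12])
  then have 1: "eigenfunction 18 (\<lambda>i j. of_bool (parent_adj seed_parent i j)) \<theta> v"
    unfolding eigenfunction_seed v using assms(2-19) by (intro conjI)
  have 2: "\<forall>i<18. (v i)\<^sup>2 = seed_relation i (\<lambda>j. (v j)\<^sup>2)"
    unfolding All_less_18 seed_relation_def v using assms(20-) by simp
  show ?thesis unfolding seed_eigenvalue_def using 1 2 by (intro exI[of _ v] conjI)
qed

section \<open>Explicit eigenvectors of the seed\<close>

text \<open>An eigenvector of the path on two vertices, placed with opposite signs on
  \<open>{5, 6}\<close> and \<open>{7, 8}\<close>, cancels at vertex 1.\<close>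

lemma seed_eigenvalue_1:
  assumes "\<theta>\<^sup>2 = 1"
  shows "seed_eigenvalue \<theta>"
  by (rule seed_eigenvalueI[where
        a = 0 and b = 0 and c = 0 and d = 0 and e = 0 and f = \<theta> and g = 1 and
        h = "- \<theta>" and k = "- 1" and l = 0 and m = 0 and n = 0 and p = 0 and
        q = 0 and r = 0 and s = 0 and t = 0 and u = 0])
    (use assms in \<open>simp_all add: power2_eq_square\<close>)

text \<open>Likewise for the path on four vertices, with opposite signs on \<open>{9..12}\<close>
  and \<open>{13..16}\<close>, cancelling at vertex 0.\<close>

lemma seed_eigenvalue_2:
  assumes "\<theta>\<^sup>2 = y" and "y\<^sup>2 - 3 * y + 1 = 0"
  shows "seed_eigenvalue \<theta>"
proof -
  \<comment> \<open>Rewrite rules that reduce polynomials in \<open>\<theta>\<close> and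
    \<open>y\<close> modulo the two assumptions; the forms with \<open>z\<close> reach inside longer
    products.\<close>
  have t: "\<theta> * \<theta> = y" "\<And>z. \<theta> * (\<theta> * z) = y * z"
    using assms(1) by (simp_all add: power2_eq_square flip: mult.assoc)
  have c: "y * y = 3 * y - 1"
    using assms(2) by (simp add: power2_eq_square power3_eq_cube algebra_simps)
  have c': "y * (y * z) = (3 * y - 1) * z" for z
    using arg_cong[OF c, of "\<lambda>x. x * z"] by (simp only: mult.assoc)
  show ?thesis
    by (rule seed_eigenvalueI[where
        a = 0 and b = 0 and c = 0 and d = 0 and e = 0 and f = 0 and g = 0 and h = 0 and
        k = 0 and l = "\<theta> * (y - 2)" and m = "y - 1" and n = \<theta> and p = 1 and
        q = "- (\<theta> * (y - 2))" and r = "- (y - 1)" and s = "- \<theta>" and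
        t = "- 1" and u = 0])
      (simp_all add: t c c' power2_eq_square algebra_simps)
qed

text \<open>The equations are solved inwards from leaf 12 with value 1 and leaf 4 with value -1. The
  cubic turns the quotients by \<open>\<theta>\<close> at leaves 6, 8 and 17 into
  polynomials.\<close>

lemma seed_eigenvalue_3:
  assumes "\<theta>\<^sup>2 = y" and "y ^ 3 - 5 * y\<^sup>2 + 6 * y - 1 = 0"
  shows "seed_eigenvalue \<theta>"
proof -
  have t: "\<theta> * \<theta> = y" "\<And>z. \<theta> * (\<theta> * z) = y * z"
    using assms(1) by (simp_all add: power2_eq_square flip: mult.assoc)
  have c: "y * (y * y) = 5 * (y * y) - 6 * y + 1"
    using assms(2) by (simp add: power2_eq_square power3_eq_cube algebra_simps)
  have c': "y * (y * (y * z)) = (5 * (y * y) - 6 * y + 1) * z" for z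
    using arg_cong[OF c, of "\<lambda>x. x * z"] by (simp only: mult.assoc)
  show ?thesis
    by (rule seed_eigenvalueI[where
        a = "y\<^sup>2 - 3 * y + 1" and b = "\<theta> * (2 - y)" and c = "1 - y" and
        d = "- \<theta>" and e = "- 1" and f = "3 * y - 1 - y\<^sup>2" and
        g = "\<theta> * (4 * y - 3 - y\<^sup>2)" and h = "3 * y - 1 - y\<^sup>2" and
        k = "\<theta> * (4 * y - 3 - y\<^sup>2)" and l = "\<theta> * (y - 2)" and
        m = "y - 1" and n = \<theta> and p = 1 and q = "\<theta> * (y - 2)" and
        r = "y - 1" and s = \<theta> and t = 1 and u = "\<theta> * (y\<^sup>2 - 4 * y + 3)"])
      (simp_all add: t c c' power2_eq_square algebra_simps)
qed

text \<open>Solved inwards in the same way, from the values 2 at leaf 12 and 4 at leaf 4.\<close>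

lemma seed_eigenvalue_4:
  assumes "\<theta>\<^sup>2 = y" and "y ^ 3 - 8 * y\<^sup>2 + 12 * y - 1 = 0"
  shows "seed_eigenvalue \<theta>"
proof -
  have t: "\<theta> * \<theta> = y" "\<And>z. \<theta> * (\<theta> * z) = y * z"
    using assms(1) by (simp_all add: power2_eq_square flip: mult.assoc)
  have c: "y * (y * y) = 8 * (y * y) - 12 * y + 1"
    using assms(2) by (simp add: power2_eq_square power3_eq_cube algebra_simps)
  have c': "y * (y * (y * z)) = (8 * (y * y) - 12 * y + 1) * z" for z
    using arg_cong[OF c, of "\<lambda>x. x * z"] by (simp only: mult.assoc)
  show ?thesis
    by (rule seed_eigenvalueI[where
        a = "2 * y\<^sup>2 - 6 * y + 2" and b = "\<theta> * (4 * y - 8)" and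
        c = "4 * y - 4" and d = "4 * \<theta>" and e = 4 and
        f = "y\<^sup>2 - 3 * y + 1" and g = "\<theta> * (y\<^sup>2 - 7 * y + 9)" and
        h = "y\<^sup>2 - 3 * y + 1" and k = "\<theta> * (y\<^sup>2 - 7 * y + 9)" and
        l = "\<theta> * (2 * y - 4)" and m = "2 * y - 2" and n = "2 * \<theta>" and
        p = 2 and q = "\<theta> * (2 * y - 4)" and r = "2 * y - 2" and
        s = "2 * \<theta>" and t = 2 and u = "\<theta> * (2 * y\<^sup>2 - 14 * y + 18)"])
      (simp_all add: t c c' power2_eq_square algebra_simps)
qed

text \<open>Sign changes isolate the eight roots other than 1 in pairwise disjoint intervals that
  avoid 1, so listing the roots in increasing order proves them distinct.\<close>

lemma nine_squared_eigenvalues: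
  "\<exists>Y :: real set. finite Y \<and> card Y = 9 \<and> (\<forall>y\<in>Y. 0 < y \<and> (y = 1 \<or> y\<^sup>2 - 3 * y + 1 = 0
     \<or> y ^ 3 - 5 * y\<^sup>2 + 6 * y - 1 = 0 \<or> y ^ 3 - 8 * y\<^sup>2 + 12 * y - 1 = 0))"
proof -
  let ?p = "\<lambda>y::real. y\<^sup>2 - 3 * y + 1" and ?q = "\<lambda>y::real. y ^ 3 - 5 * y\<^sup>2 + 6 * y - 1"
    and ?r = "\<lambda>y::real. y ^ 3 - 8 * y\<^sup>2 + 12 * y - 1"
  have "\<exists>y\<ge>1/20. y \<le> 1/10 \<and> ?r y = 0" "\<exists>y\<ge>3/20. y \<le> 1/4 \<and> ?q y = 0" "\<exists>y\<ge>5/2. y \<le> 27/10 \<and> ?p y = 0"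
    "\<exists>y\<ge>3. y \<le> 7/2 \<and> ?q y = 0" "\<exists>y\<ge>6. y \<le> 7 \<and> ?r y = 0"
    by (rule IVT'; (simp add: power_divide | intro continuous_intros))+
  \<comment> \<open>Here the polynomials change sign from plus to minus, above from minus to
    plus.\<close>
  moreover have "\<exists>y\<ge>3/10. y \<le> 1/2 \<and> ?p y = 0" "\<exists>y\<ge>3/2. y \<le> 8/5 \<and> ?q y = 0" "\<exists>y\<ge>17/10. y \<le> 2 \<and> ?r y = 0"
    by (rule IVT2'; (simp add: power_divide | intro continuous_intros))+
  ultimately obtain a b c d e f g h where
    a: "1/20 \<le> a" "a \<le> 1/10" "?r a = 0" and b: "3/20 \<le> b" "b \<le> 1/4" "?q b = 0" and
    c: "3/10 \<le> c" "c \<le> 1/2" "?p c = 0" and d: "3/2 \<le> d" "d \<le> 8/5" "?q d = 0" and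
    e: "17/10 \<le> e" "e \<le> 2" "?r e = 0" and f: "5/2 \<le> f" "f \<le> 27/10" "?p f = 0" and
    g: "3 \<le> g" "g \<le> 7/2" "?q g = 0" and h: "6 \<le> h" "h \<le> 7" "?r h = 0"
    by metis
  have "sorted_wrt (<) [a, b, c, 1, d, e, f, g, h]"
    using a b c d e f g h by simp
  then have "distinct [a, b, c, 1, d, e, f, g, h]"
    unfolding strict_sorted_iff by (rule conjunct2)
  then have "card (set [a, b, c, 1, d, e, f, g, h]) = 9"
    unfolding distinct_card[OF \<open>distinct _\<close>] by simp
  then show ?thesis
    using a b c d e f g h by (intro exI[of _ "set [a, b, c, 1, d, e, f, g, h]"]) simp
qed

text \<open>Each of the nine positive values \<open>y\<close> gives two eigenvalues,
  \<open>sqrt y\<close> and its negative, 18 in all.\<close>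

lemma low_square_rank_seed:
  "low_square_rank 18 (\<lambda>i j. of_bool (parent_adj seed_parent i j)) 8"
proof -
  obtain Y :: "real set" where Y: "finite Y" "card Y = 9" and roots:
    "\<And>y. y \<in> Y \<Longrightarrow> 0 < y \<and> (y = 1 \<or> y\<^sup>2 - 3 * y + 1 = 0
     \<or> y ^ 3 - 5 * y\<^sup>2 + 6 * y - 1 = 0 \<or> y ^ 3 - 8 * y\<^sup>2 + 12 * y - 1 = 0)"
    using nine_squared_eigenvalues by blast
  let ?m = "\<lambda>y. - sqrt y"
  have ev: "seed_eigenvalue \<theta>" if "\<theta>\<^sup>2 \<in> Y" for \<theta>
    using roots[OF that] seed_eigenvalue_1 seed_eigenvalue_2 seed_eigenvalue_3 seed_eigenvalue_4
    by blast
  have "sqrt x \<noteq> - sqrt y" if "x \<in> Y" "y \<in> Y" for x y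
    using roots[OF that(1)] roots[OF that(2)] real_sqrt_gt_zero[of x] real_sqrt_gt_zero[of y] by linarith
  then have disj: "sqrt ` Y \<inter> ?m ` Y = {}" by auto
  have "card (sqrt ` Y \<union> ?m ` Y) = 18"
    using Y by (simp add: card_Un_disjoint[OF _ _ disj] card_image inj_on_def)
  then show ?thesis
  proof (rule low_square_rankI)
    show "card {0, 1, 3, 4, 6, 11, 12, 17::nat} = 8" "{0, 1, 3, 4, 6, 11, 12, 17::nat} \<subseteq> {..<18}"
      by simp_all
    show "finite (sqrt ` Y \<union> ?m ` Y)" using Y by simp
    fix \<theta>
    assume "\<theta> \<in> sqrt ` Y \<union> ?m ` Y"
    then have "\<theta>\<^sup>2 \<in> Y" using roots by (force simp: less_imp_le)
    from ev[OF this] obtain v where eig: "eigenfunction 18 (\<lambda>i j. of_bool (parent_adj seed_parent i j)) \<theta> v"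
      and sq: "\<forall>i<18. (v i)\<^sup>2 = seed_relation i (\<lambda>j. (v j)\<^sup>2)"
      unfolding seed_eigenvalue_def by blast
    show "\<exists>v. eigenfunction 18 (\<lambda>i j. of_bool (parent_adj seed_parent i j)) \<theta> v \<and>
        (\<forall>i<18. (v i)\<^sup>2
          = (\<Sum>j\<in>{0, 1, 3, 4, 6, 11, 12, 17}. seed_relation i (\<lambda>k. of_bool (k = j)) * (v j)\<^sup>2))"
    proof (intro exI[of _ v] conjI allI impI)
      fix i :: nat
      assume i: "i < 18"
      show "(v i)\<^sup>2 = (\<Sum>j\<in>{0, 1, 3, 4, 6, 11, 12, 17}. seed_relation i (\<lambda>k. of_bool (k = j)) * (v j)\<^sup>2)"
        by (rule trans[OF sq[rule_format, OF i] seed_relation_eq_sum[rule_format, OF i]])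
    qed (rule eig)
  qed
qed

theorem theorem4p4:
  fixes c :: real
  assumes "c > 0"
  shows "\<exists>T :: nat pair_pre_digraph. undirected_tree T \<and> has_simple_eigenvalues T \<and>
    real_of_int \<lceil>real (card (pverts T)) / 2\<rceil> - real (mat_rank (average_mixing_matrix T)) > c"
proof -
  \<comment> \<open>The seed has gap \<open>9 - 8 = 1\<close>, so \<open>k\<close> rounds give at
    least \<open>2 ^ k\<close>.\<close>
  obtain k where k: "c < 2 ^ k" using real_arch_pow[of 2 c] by auto
  obtain q where tree: "parent_tree (2 ^ k * 18) q"
    and low: "low_square_rank (2 ^ k * 18) (\<lambda>i j. of_bool (parent_adj q i j)) (2 ^ k * 8)"
    using iterated_corona[OF parent_tree_seed _ low_square_rank_seed] by auto
  let ?T = "parent_graph (2 ^ k * 18) q"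
  have "undirected_tree ?T"
    using parent_tree.undirected_tree_parent_graph[OF tree] by simp
  moreover have "has_simple_eigenvalues ?T" and rank: "mat_rank (average_mixing_matrix ?T) \<le> 2 ^ k * 8"
    using low_square_rankD[OF low _ adjacency_matrix_parent_graph] by (simp_all add: parent_adj_sym)
  moreover have "real_of_int \<lceil>real (card (pverts ?T)) / 2\<rceil> - real (mat_rank (average_mixing_matrix ?T)) > c"
  proof -
    have "real (mat_rank (average_mixing_matrix ?T)) \<le> 2 ^ k * 8"
      using of_nat_mono[OF rank, where 'a = real] by simp
    moreover have "real_of_int \<lceil>real (card (pverts ?T)) / 2\<rceil> \<ge> 2 ^ k * 9"
      using le_of_int_ceiling[of "real (card (pverts ?T)) / 2"] by simp
    ultimately show ?thesis using k by simp
  qed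
  ultimately show ?thesis by blast
qed

end
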